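(* Let $G$ be a non-locally cyclic group of order $n$, where $n$ and $t=|Cyc(G)|$ are odd. Then $\gamma(\overline{\Gamma}_G)=\frac{n-t}{2}$ if and only if $t=1$ and $\overline{\Gamma}_G$ is isomorphic to the disjoint union of $\frac{n-1}{2}$ copies of $P_2$.
   Context: A group is locally cyclic if every finitely generated subgroup is cyclic (so a finite group is non-locally cyclic iff it is not cyclic). For a group $G$, the cyclicizer is $Cyc(G)=\{y\in G \mid \langle x,y\rangle \text{ is cyclic for all } x\in G\}$. For a non-locally cyclic finite group $G$, the non-cyclic graph $\Gamma_G$ is the simple graph with vertex set $G\setminus Cyc(G)$ in which two distinct vertices $x,y$ are adjacent if and only if $\langle x,y\rangle$ is not cyclic; $\overline{\Gamma}_G$ is its complement (same vertex set, distinct $x,y$ adjacent iff $\langle x,y\rangle$ is cyclic). For a graph $\Gamma$, a dominating set is a set $D$ of vertices such that every vertex not in $D$ is adjacent to at least one vertex of $D$; the domination number $\gamma(\Gamma)$ is the smallest cardinality of a dominating set. $P_2$ is the path on two vertices (a single edge). *)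

theory Defs
  imports Complex_Main "HOL-Algebra.Elementary_Groups" "Graph_Theory.Graph_Theory"
begin

definition locally_cyclic_group :: "('a, 'm) monoid_scheme \<Rightarrow> bool" where
  "locally_cyclic_group G \<longleftrightarrow>
     (\<forall>S. finite S \<and> S \<subseteq> carrier G \<longrightarrow> cyclic_group (subgroup_generated G S))"

definition cyclicizer :: "('a, 'm) monoid_scheme \<Rightarrow> 'a set" where
  "cyclicizer G =
     {y \<in> carrier G. \<forall>x \<in> carrier G. cyclic_group (subgroup_generated G {x, y})}"

text \<open>
  Simple graphs are rendered as pair digraphs satisfying \<^locale>\<open>pair_graph\<close>: finite, without
  loops, and with an arc relation that is symmetric, so that an edge between u and v is
  the pair of arcs (u, v) and (v, u).
\<close>

definition non_cyclic_graph :: "('a, 'm) monoid_scheme \<Rightarrow> 'a pair_pre_digraph" where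
  "non_cyclic_graph G =
     \<lparr> pverts = carrier G - cyclicizer G,
       parcs = {(x, y). x \<in> carrier G - cyclicizer G \<and> y \<in> carrier G - cyclicizer G \<and>
                        x \<noteq> y \<and> \<not> cyclic_group (subgroup_generated G {x, y})} \<rparr>"

definition graph_complement :: "'a pair_pre_digraph \<Rightarrow> 'a pair_pre_digraph" where
  "graph_complement H =
     \<lparr> pverts = pverts H,
       parcs = {(u, v). u \<in> pverts H \<and> v \<in> pverts H \<and> u \<noteq> v \<and> (u, v) \<notin> parcs H} \<rparr>"

definition dominating_set :: "'a pair_pre_digraph \<Rightarrow> 'a set \<Rightarrow> bool" where
  "dominating_set H D \<longleftrightarrow>
     D \<subseteq> pverts H \<and> (\<forall>v \<in> pverts H - D. \<exists>u \<in> D. (v, u) \<in> parcs H)"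

text \<open>
  Finiteness of D is required because \<^const>\<open>card\<close> is 0 on infinite sets; the value is
  meaningful for every graph with a finite dominating set, in particular for finite graphs.
\<close>

definition domination_number :: "'a pair_pre_digraph \<Rightarrow> nat" where
  "domination_number H = (LEAST k. \<exists>D. finite D \<and> dominating_set H D \<and> card D = k)"

text \<open>The path with k vertices (not k edges), on the vertices 0, ..., k - 1.\<close>

definition path_graph :: "nat \<Rightarrow> nat pair_pre_digraph" where
  "path_graph k =
     \<lparr> pverts = {..<k},
       parcs = {(i, j). i < k \<and> j < k \<and> (j = Suc i \<or> i = Suc j)} \<rparr>"

definition disjoint_copies :: "nat \<Rightarrow> 'a pair_pre_digraph \<Rightarrow> (nat \<times> 'a) pair_pre_digraph" where
  "disjoint_copies k H =
     \<lparr> pverts = {..<k} \<times> pverts H,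
       parcs = {((i, u), (j, v)) |i j u v. i < k \<and> i = j \<and> (u, v) \<in> parcs H} \<rparr>"

definition graph_isomorphic :: "'a pair_pre_digraph \<Rightarrow> 'b pair_pre_digraph \<Rightarrow> bool" where
  "graph_isomorphic H K \<longleftrightarrow> digraph_iso (with_proj H) (with_proj K)"

lemma pair_graphI:
  assumes "finite (pverts H)"
    and "\<And>u v. (u, v) \<in> parcs H \<Longrightarrow> u \<in> pverts H \<and> v \<in> pverts H \<and> u \<noteq> v \<and> (v, u) \<in> parcs H"
  shows "pair_graph H"
proof -
  have "parcs H \<subseteq> pverts H \<times> pverts H"
    using assms(2) by auto
  then have "finite (parcs H)"
    using assms(1) by (meson finite_SigmaI finite_subset)
  with assms show ?thesis
    by unfold_locales (auto simp: symmetric_def sym_def)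
qed

lemma pair_graph_non_cyclic_graph:
  assumes "finite (carrier G)"
  shows "pair_graph (non_cyclic_graph G)"
  using assms by (intro pair_graphI) (auto simp: non_cyclic_graph_def insert_commute)

lemma pair_graph_graph_complement:
  assumes "pair_graph H"
  shows "pair_graph (graph_complement H)"
proof -
  interpret pair_graph H by (fact assms)
  show ?thesis
    using pair_sym_arcs
    by (intro pair_graphI) (auto simp: graph_complement_def symmetric_def sym_def)
qed

lemma pair_graph_path_graph: "pair_graph (path_graph k)"
  by (intro pair_graphI) (auto simp: path_graph_def)

lemma pair_graph_disjoint_copies:
  assumes "pair_graph H"
  shows "pair_graph (disjoint_copies k H)"
proof -
  interpret pair_graph H by (fact assms)
  show ?thesis
    using pair_sym_arcs
    by (intro pair_graphI)
      (auto simp: disjoint_copies_def symmetric_def sym_def dest: in_arcsD1 in_arcsD2 pair_no_loops)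
qed

text \<open>
  Between simple graphs, the digraph isomorphisms of the library are the edge-preserving and
  edge-reflecting bijections of the vertex sets.
\<close>

lemma graph_isomorphic_iff:
  assumes "pair_graph H" "pair_graph K"
  shows "graph_isomorphic H K \<longleftrightarrow>
    (\<exists>f. bij_betw f (pverts H) (pverts K) \<and>
         (\<forall>u \<in> pverts H. \<forall>v \<in> pverts H. (u, v) \<in> parcs H \<longleftrightarrow> (f u, f v) \<in> parcs K))"
    (is "?L \<longleftrightarrow> ?R")
proof
  interpret H: pair_graph H by (fact assms(1))
  assume ?L
  then obtain h where h: "pre_digraph.digraph_isomorphism (with_proj H) h"
    and K: "with_proj K = app_iso h (with_proj H)"
    by (auto simp: graph_isomorphic_def digraph_iso_def)
  have V: "pverts K = iso_verts h ` pverts H" and A: "parcs K = iso_arcs h ` parcs H"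
    and T: "iso_tail h = fst" and S: "iso_head h = snd"
    using K by (auto simp: app_iso_def with_proj_def)
  have inj: "inj_on (iso_verts h) (pverts H)"
    using h by (simp add: pre_digraph.digraph_isomorphism_def)
  have arc: "iso_arcs h (u, v) = (iso_verts h u, iso_verts h v)" if "(u, v) \<in> parcs H" for u v
    using h that T S by (auto simp: pre_digraph.digraph_isomorphism_def prod_eq_iff)
  have "(u, v) \<in> parcs H" if "u \<in> pverts H" "v \<in> pverts H"
    "(iso_verts h u, iso_verts h v) \<in> parcs K" for u v
  proof -
    from that(3) A obtain a b where ab: "(a, b) \<in> parcs H"
      "(iso_verts h u, iso_verts h v) = iso_arcs h (a, b)" by auto
    with arc have "iso_verts h u = iso_verts h a" "iso_verts h v = iso_verts h b" by auto
    with ab(1) that inj show ?thesis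
      by (metis H.in_arcsD1 H.in_arcsD2 inj_onD)
  qed
  moreover have "(iso_verts h u, iso_verts h v) \<in> parcs K" if "(u, v) \<in> parcs H" for u v
    using arc[OF that] A that by (metis imageI)
  ultimately show ?R
    using V inj by (intro exI[of _ "iso_verts h"]) (auto simp: bij_betw_def)
next
  interpret H: pair_graph H by (fact assms(1))
  interpret K: pair_graph K by (fact assms(2))
  assume ?R
  then obtain f where inj: "inj_on f (pverts H)" and V: "pverts K = f ` pverts H"
    and E: "\<And>u v. u \<in> pverts H \<Longrightarrow> v \<in> pverts H \<Longrightarrow> (u, v) \<in> parcs H \<longleftrightarrow> (f u, f v) \<in> parcs K"
    by (auto simp: bij_betw_def)
  define h where "h = \<lparr> iso_verts = f, iso_arcs = map_prod f f, iso_head = snd, iso_tail = fst \<rparr>"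
  have "inj_on (map_prod f f) (parcs H)"
    by (rule inj_on_subset[OF map_prod_inj_on[OF inj inj]])
      (auto dest: H.in_arcsD1 H.in_arcsD2)
  then have "pre_digraph.digraph_isomorphism (with_proj H) h"
    using inj by (auto simp: pre_digraph.digraph_isomorphism_def h_def H.wf_digraph)
  moreover have "parcs K = map_prod f f ` parcs H"
  proof (intro equalityI subsetI)
    fix e assume e: "e \<in> parcs K"
    then obtain a b where "e = (f a, f b)" "a \<in> pverts H" "b \<in> pverts H"
      using V by (metis K.in_arcsD1 K.in_arcsD2 imageE prod.exhaust)
    with e E show "e \<in> map_prod f f ` parcs H"
      by (auto intro: rev_image_eqI)
  next
    fix e assume "e \<in> map_prod f f ` parcs H"
    then obtain a b where "(a, b) \<in> parcs H" "e = (f a, f b)" by auto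
    with E show "e \<in> parcs K" by (meson H.in_arcsD1 H.in_arcsD2)
  qed
  then have "with_proj K = app_iso h (with_proj H)"
    using V by (simp add: app_iso_def h_def with_proj_def)
  ultimately show ?L
    by (auto simp: graph_isomorphic_def digraph_iso_def)
qed

end

theory Submission
  imports Defs "HOL-Algebra.Multiplicative_Group"
begin

text \<open>
  Write \<open>H\<close> for the complement of the non-cyclic graph, so that distinct vertices are adjacent in \<open>H\<close>
  when they lie in a common cyclic subgroup. Inversion is an involution of the vertex set which has
  no fixed points because the group order is odd. A cyclic subgroup contains \<open>x\<close> exactly when it
  contains the inverse of \<open>x\<close>, so the two are adjacent and have the same closed neighbourhood.

  Choosing one element from every pair of mutually inverse vertices gives a dominating set with
  \<open>(n - t) / 2\<close> elements. If some \<open>x\<close> is adjacent to a vertex \<open>y\<close> other than its inverse, then the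
  representative of \<open>x\<close> also dominates both members of the pair of \<open>y\<close>, and the representative
  of that pair can be dropped (\<open>domination_number_less_half\<close>). So if the domination number is
  \<open>(n - t) / 2\<close>, the edges of \<open>H\<close> are precisely the pairs of mutually inverse vertices, which makes
  \<open>H\<close> a disjoint union of edges.

  To see that then \<open>t = 1\<close>, take a vertex \<open>v\<close>, which exists since \<open>G\<close> is not locally cyclic. For every
  \<open>z \<noteq> \<one>\<close> in the cyclicizer both \<open>v \<otimes> z\<close> and \<open>v \<otimes> inv z\<close> are neighbours of \<open>v\<close>, because
  the cyclicizer is a subgroup. Both must equal \<open>inv v\<close>, so \<open>z\<close> is its own inverse, which is
  impossible in odd order (\<open>cyclicizer_trivial_if_arcs_inv\<close>).

  For the converse, the domination number is invariant under isomorphism, and a disjoint union of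
  \<open>k\<close> edges has domination number \<open>k\<close>, since every edge must meet a dominating set.
\<close>

section \<open>Domination numbers\<close>

lemma domination_number_le:
  assumes "dominating_set H D" "finite D"
  shows "domination_number H \<le> card D"
  unfolding domination_number_def using assms by (intro Least_le) auto

lemma domination_number_attained:
  assumes "finite (pverts H)"
  obtains D where "finite D" "dominating_set H D" "card D = domination_number H"
proof -
  have "dominating_set H (pverts H)" by (simp add: dominating_set_def)
  then have "\<exists>k D. finite D \<and> dominating_set H D \<and> card D = k" using assms by blast
  then have "\<exists>D. finite D \<and> dominating_set H D \<and> card D = domination_number H"
    unfolding domination_number_def by (rule LeastI_ex)
  with that show ?thesis by blast
qed

text \<open>
  An edge-preserving bijection carries dominating sets to dominating sets. For an isomorphism this
  applies to the inverse as well and gives equality.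
\<close>
lemma domination_number_le_if_isomorphic:
  assumes "finite (pverts H)" and f: "bij_betw f (pverts H) (pverts K)"
    and arcs: "\<And>u v. u \<in> pverts H \<Longrightarrow> v \<in> pverts H \<Longrightarrow> (u, v) \<in> parcs H \<Longrightarrow> (f u, f v) \<in> parcs K"
  shows "domination_number K \<le> domination_number H"
proof -
  obtain D where D: "finite D" "dominating_set H D" "card D = domination_number H"
    using domination_number_attained[OF assms(1)] .
  then have sub: "D \<subseteq> pverts H" by (simp add: dominating_set_def)
  have "dominating_set K (f ` D)"
    unfolding dominating_set_def
  proof (intro conjI ballI)
    show "f ` D \<subseteq> pverts K" using sub f by (auto simp: bij_betw_def)
    fix v assume "v \<in> pverts K - f ` D"
    then obtain w where w: "w \<in> pverts H - D" "v = f w"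
      using f unfolding bij_betw_def by blast
    then obtain u where "u \<in> D" "(w, u) \<in> parcs H"
      using D(2) by (auto simp: dominating_set_def)
    then show "\<exists>u \<in> f ` D. (v, u) \<in> parcs K"
      using w sub arcs by blast
  qed
  then have "domination_number K \<le> card (f ` D)"
    using D(1) by (intro domination_number_le) auto
  also have "\<dots> \<le> domination_number H"
    using D(1,3) card_image_le by metis
  finally show ?thesis .
qed

lemma domination_number_isomorphic:
  assumes "pair_graph H" "pair_graph K" "graph_isomorphic H K"
  shows "domination_number H = domination_number K"
proof -
  interpret H: pair_graph H by (fact assms(1))
  interpret K: pair_graph K by (fact assms(2))
  obtain f where f: "bij_betw f (pverts H) (pverts K)"
    and E: "\<And>u v. u \<in> pverts H \<Longrightarrow> v \<in> pverts H \<Longrightarrow> (u, v) \<in> parcs H \<longleftrightarrow> (f u, f v) \<in> parcs K"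
    using assms by (auto simp: graph_isomorphic_iff)
  let ?g = "inv_into (pverts H) f"
  have g: "bij_betw ?g (pverts K) (pverts H)" by (rule bij_betw_inv_into[OF f])
  show ?thesis
  proof (rule antisym)
    show "domination_number H \<le> domination_number K"
    proof (rule domination_number_le_if_isomorphic[OF _ g])
      fix u v assume "u \<in> pverts K" "v \<in> pverts K" "(u, v) \<in> parcs K"
      then show "(?g u, ?g v) \<in> parcs H"
        using E[of "?g u" "?g v"] f g by (simp add: bij_betw_inv_into_right bij_betw_apply)
    qed auto
    show "domination_number K \<le> domination_number H"
      using E by (intro domination_number_le_if_isomorphic[OF _ f]) auto
  qed
qed

text \<open>
  One end of every edge dominates. Conversely a vertex has neighbours only in its own copy, so a
  dominating set projects onto the set of copies.
\<close>
lemma domination_number_copies_of_edge: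
  "domination_number (disjoint_copies k (path_graph 2)) = k"
proof (rule antisym)
  let ?K = "disjoint_copies k (path_graph 2)"
  let ?Z = "{..<k} \<times> {0::nat}"
  have "dominating_set ?K ?Z"
    by (auto simp: dominating_set_def disjoint_copies_def path_graph_def less_2_cases_iff)
  then have "domination_number ?K \<le> card ?Z" by (rule domination_number_le) auto
  then show "domination_number ?K \<le> k" by (simp add: card_cartesian_product)
  have "finite (pverts ?K)" by (simp add: disjoint_copies_def path_graph_def)
  then obtain D where D: "finite D" "dominating_set ?K D" "card D = domination_number ?K"
    by (rule domination_number_attained)
  have "{..<k} \<subseteq> fst ` D"
  proof
    fix j assume "j \<in> {..<k}"
    then have "(j, 0) \<in> pverts ?K" by (simp add: disjoint_copies_def path_graph_def)
    then have "(j, 0) \<in> D \<or> (\<exists>u \<in> D. ((j, 0), u) \<in> parcs ?K)"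
      using D(2) by (auto simp: dominating_set_def)
    then show "j \<in> fst ` D" by (force simp: disjoint_copies_def)
  qed
  then have "card {..<k} \<le> card (fst ` D)" using D(1) by (intro card_mono) auto
  also have "\<dots> \<le> card D" by (rule card_image_le[OF D(1)])
  finally show "k \<le> domination_number ?K" using D(3) by simp
qed

section \<open>Graphs with an involution that swaps adjacent twins\<close>

lemma involution_transversal:
  assumes "finite V"
    and "\<And>v. v \<in> V \<Longrightarrow> i v \<in> V" "\<And>v. v \<in> V \<Longrightarrow> i (i v) = v" "\<And>v. v \<in> V \<Longrightarrow> i v \<noteq> v"
  obtains T where "V = T \<union> i ` T" "T \<inter> i ` T = {}" "card V = 2 * card T"
proof -
  have "\<exists>T. V = T \<union> i ` T \<and> T \<inter> i ` T = {}"
    using assms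
  proof (induction rule: finite_psubset_induct)
    case (psubset V)
    show ?case
    proof (cases "V = {}")
      case True
      then show ?thesis by auto
    next
      case False
      then obtain v where v: "v \<in> V" by auto
      let ?W = "V - {v, i v}"
      have "?W \<subset> V" using v by auto
      moreover have "i w \<in> ?W" if "w \<in> ?W" for w
        using that v psubset.prems by (metis Diff_iff insert_iff empty_iff)
      ultimately obtain T where T: "?W = T \<union> i ` T" "T \<inter> i ` T = {}"
        using psubset.IH[of ?W] psubset.prems by auto
      have W: "T \<subseteq> ?W" "i ` T \<subseteq> ?W" using T(1) by auto
      have "V = insert v T \<union> i ` insert v T"
        using T(1) v psubset.prems(1)[OF v] by auto
      moreover have "insert v T \<inter> i ` insert v T = {}"
        using T(2) W psubset.prems(3)[OF v] by auto
      ultimately show ?thesis by blast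
    qed
  qed
  then obtain T where T: "V = T \<union> i ` T" "T \<inter> i ` T = {}" by auto
  moreover have "inj_on i T" using T(1) assms(3) by (metis UnI1 inj_onI)
  moreover have "finite T" using T(1) assms(1) finite_subset by blast
  ultimately have "card V = 2 * card T"
    by (simp add: card_Un_disjoint card_image)
  with T that show ?thesis by blast
qed

text \<open>
  By \<open>twin\<close> and the symmetry of the arcs, an edge between two distinct pairs of the involution makes
  the two pairs completely joined. Then the representative of one pair dominates the other pair, which
  need not contribute to the dominating set.
\<close>
lemma domination_number_less_half:
  assumes H: "pair_graph H"
    and inv: "\<And>v. v \<in> pverts H \<Longrightarrow> i v \<in> pverts H" "\<And>v. v \<in> pverts H \<Longrightarrow> i (i v) = v"
      "\<And>v. v \<in> pverts H \<Longrightarrow> i v \<noteq> v"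
    and adj: "\<And>v. v \<in> pverts H \<Longrightarrow> (v, i v) \<in> parcs H"
    and twin: "\<And>u v. (u, v) \<in> parcs H \<Longrightarrow> v \<noteq> i u \<Longrightarrow> (i u, v) \<in> parcs H"
    and arc: "(x, y) \<in> parcs H" "y \<noteq> i x"
  shows "2 * domination_number H < card (pverts H)"
proof -
  interpret pair_graph H by (fact H)
  have xy: "x \<in> pverts H" "y \<in> pverts H" "x \<noteq> y" "(y, x) \<in> parcs H"
    using in_arcsD1[OF arc(1)] in_arcsD2[OF arc(1)] pair_no_loops[OF arc(1)] pair_sym_arcs arc(1)
    by (simp_all add: symmetric_def sym_def)
  obtain T where T: "pverts H = T \<union> i ` T" "card (pverts H) = 2 * card T"
    using involution_transversal[OF pair_finite_verts inv] by metis
  have fin: "finite T" using T(1) pair_finite_verts by (metis finite_Un)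
  have rep: "v \<in> T \<or> i v \<in> T" if "v \<in> pverts H" for v
    using that T(1) inv(2) by auto
  obtain x' where x': "x' \<in> T" "x' = x \<or> x' = i x" using rep[OF xy(1)] by auto
  obtain y' where y': "y' \<in> T" "y' = y \<or> y' = i y" using rep[OF xy(2)] by auto
  have ne: "x' \<noteq> y'" using x' y' xy arc(2) inv by metis
  \<comment> \<open>replacing either end of the edge by its twin gives all four edges between the two pairs\<close>
  have dom: "(w, x') \<in> parcs H" if "w \<in> {y', i y'}" for w
  proof -
    have "(y, i x) \<in> parcs H"
      using twin[OF arc] pair_sym_arcs by (simp add: symmetric_def sym_def)
    moreover have "i x \<noteq> i y" "x \<noteq> i y"
      using xy arc(2) inv(2) by metis+
    ultimately have "(i y, x) \<in> parcs H" "(y, i x) \<in> parcs H" "(i y, i x) \<in> parcs H"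
      using twin xy(4) by blast+
    moreover have "w = y \<or> w = i y"
      using that y' xy(2) inv(2) by auto
    ultimately show ?thesis
      using xy(4) x'(2) by auto
  qed
  have "dominating_set H (T - {y'})"
    unfolding dominating_set_def
  proof (intro conjI ballI)
    fix v assume v: "v \<in> pverts H - (T - {y'})"
    show "\<exists>u \<in> T - {y'}. (v, u) \<in> parcs H"
    proof (cases "v \<in> {y', i y'}")
      case True
      then show ?thesis using dom x' ne by blast
    next
      case False
      then have "i v \<in> T - {y'}" using v rep inv(2) by auto
      then show ?thesis using adj v by blast
    qed
  qed (use T(1) in auto)
  then have "domination_number H \<le> card (T - {y'})" using fin by (intro domination_number_le) auto
  also have "\<dots> < card T" using fin y'(1) by (intro card_Diff1_less)
  finally show ?thesis using T(2) by simp
qed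

lemma matching_isomorphic_copies_of_edge:
  assumes H: "pair_graph H"
    and inv: "\<And>v. v \<in> pverts H \<Longrightarrow> i v \<in> pverts H" "\<And>v. v \<in> pverts H \<Longrightarrow> i (i v) = v"
      "\<And>v. v \<in> pverts H \<Longrightarrow> i v \<noteq> v"
    and arcs: "\<And>u v. u \<in> pverts H \<Longrightarrow> v \<in> pverts H \<Longrightarrow> (u, v) \<in> parcs H \<longleftrightarrow> v = i u"
  shows "graph_isomorphic H (disjoint_copies (card (pverts H) div 2) (path_graph 2))"
proof -
  interpret pair_graph H by (fact H)
  obtain T where T: "pverts H = T \<union> i ` T" "T \<inter> i ` T = {}" "card (pverts H) = 2 * card T"
    using involution_transversal[OF pair_finite_verts inv] by metis
  have fin: "finite T" using T(1) pair_finite_verts by (metis finite_Un)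
  obtain e where e: "bij_betw e T {..<card T}"
    using ex_bij_betw_finite_nat[OF fin] by (auto simp: lessThan_atLeast0)
  \<comment> \<open>\<open>T\<close> indexes the copies and supplies the end \<open>0\<close> of each, its image under \<open>i\<close> the end \<open>1\<close>\<close>
  define f where "f v = (if v \<in> T then (e v, 0::nat) else (e (i v), 1))" for v
  have iT: "i v \<notin> T" "i (i v) = v" if "v \<in> T" for v
    using that T inv by auto
  have inj: "e u = e v \<longleftrightarrow> u = v" if "u \<in> T" "v \<in> T" for u v
    using that e by (metis bij_betw_inv_into_left)
  have eT: "e v < card T" if "v \<in> T" for v using e that by (auto simp: bij_betw_def)
  have fT: "f v = (e v, 0)" "f (i v) = (e v, 1)" if "v \<in> T" for v
    using iT[OF that] that by (auto simp: f_def)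
  have "inj_on f (pverts H)"
    unfolding T(1) using fT inj by (auto simp: inj_on_def)
  moreover have "f ` pverts H = {..<card T} \<times> {..<2}"
  proof -
    have "f ` pverts H = (\<lambda>v. (e v, 0)) ` T \<union> (\<lambda>v. (e v, 1)) ` T"
      unfolding T(1) image_Un image_image using fT by simp
    also have "\<dots> = e ` T \<times> {0} \<union> e ` T \<times> {1}" by auto
    also have "e ` T = {..<card T}" using e by (auto simp: bij_betw_def)
    also have "{..<card T} \<times> {0} \<union> {..<card T} \<times> {1} = {..<card T} \<times> {..<2::nat}"
      by (simp add: lessThan_Suc numeral_2_eq_2 insert_commute flip: Sigma_Un_distrib2)
    finally show ?thesis .
  qed
  moreover have "(u, v) \<in> parcs H \<longleftrightarrow> (f u, f v) \<in> parcs (disjoint_copies (card T) (path_graph 2))"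
    if "u \<in> pverts H" "v \<in> pverts H" for u v
  proof -
    have ends: "((p, x), (q, y)) \<in> parcs (disjoint_copies (card T) (path_graph 2)) \<longleftrightarrow>
        p < card T \<and> p = q \<and> (x = 0 \<and> y = 1 \<or> x = 1 \<and> y = 0)" for p q x y
      by (auto simp: disjoint_copies_def path_graph_def)
    obtain a where a: "a \<in> T" "u = a \<or> u = i a" using \<open>u \<in> pverts H\<close> T(1) by auto
    obtain b where b: "b \<in> T" "v = b \<or> v = i b" using \<open>v \<in> pverts H\<close> T(1) by auto
    have "v = i u \<longleftrightarrow> a = b \<and> (u = a \<longleftrightarrow> v \<noteq> b)"
      using a b iT by metis
    also have "\<dots> \<longleftrightarrow> (f u, f v) \<in> parcs (disjoint_copies (card T) (path_graph 2))"
      using a(2) b(2) iT[OF a(1)] iT[OF b(1)] a(1) b(1)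
      by (elim disjE) (auto simp: fT ends inj eT)
    finally show ?thesis using arcs that by simp
  qed
  ultimately show ?thesis
    using T(3) unfolding graph_isomorphic_iff[OF H pair_graph_disjoint_copies[OF pair_graph_path_graph]]
    by (intro exI[of _ f]) (simp add: bij_betw_def disjoint_copies_def path_graph_def)
qed

section \<open>Elements in a common cyclic subgroup\<close>

text \<open>
  Unless \<open>H\<close> is trivial, a generator is the least positive power of \<open>c\<close> in \<open>H\<close>, by division with
  remainder of the exponents.
\<close>
lemma (in group) cyclic_subgroup_of_generate_singleton:
  assumes c: "c \<in> carrier G" and H: "subgroup H G" and sub: "H \<subseteq> generate G {c}"
  shows "\<exists>d \<in> carrier G. H = generate G {d}"
proof (cases "H = {\<one>}")
  case True
  then show ?thesis
    by (metis generate_one one_closed)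
next
  case False
  define P where "P k \<longleftrightarrow> 0 < k \<and> c [^] k \<in> H" for k :: nat
  have "\<exists>k. P k"
  proof -
    obtain h where h: "h \<in> H" "h \<noteq> \<one>"
      using False subgroup.one_closed[OF H] by blast
    then obtain m :: int where m: "h = c [^] m"
      using sub by (auto simp: generate_pow[OF c])
    have "m \<noteq> 0" using h m by auto
    have "c [^] \<bar>m\<bar> \<in> H"
      using h m subgroup.m_inv_closed[OF H h(1)] c by (cases "0 \<le> m") (auto simp: int_pow_neg)
    then have "c [^] nat \<bar>m\<bar> \<in> H"
      by (metis abs_ge_zero int_pow_int nat_0_le)
    with \<open>m \<noteq> 0\<close> show ?thesis by (auto simp: P_def intro!: exI[of _ "nat \<bar>m\<bar>"])
  qed
  then obtain k where Pk: "P k" and min: "\<And>j. P j \<Longrightarrow> k \<le> j"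
    by (meson LeastI_ex Least_le)
  let ?d = "c [^] k"
  have d: "?d \<in> H" "0 < k" using Pk by (auto simp: P_def)
  have "H \<subseteq> generate G {?d}"
  proof
    fix h assume h: "h \<in> H"
    then obtain m :: int where m: "h = c [^] m"
      using sub by (auto simp: generate_pow[OF c])
    define r where "r = nat (m mod int k)"
    have r: "int r = m mod int k" "r < k"
      using d(2) by (auto simp: r_def nat_less_iff)
    have mult: "c [^] (int k * (m div int k)) = ?d [^] (m div int k)"
      using c by (simp add: int_pow_pow int_pow_int flip: int_pow_int)
    have "c [^] int r = h \<otimes> inv (?d [^] (m div int k))"
      unfolding m r(1) mult[symmetric] using c
      by (simp add: minus_mult_div_eq_mod flip: int_pow_diff)
    also have "\<dots> \<in> H"
      using h d(1) by (intro subgroup.m_closed[OF H] subgroup.m_inv_closed[OF H]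
          subgroup_int_pow_closed[OF H])
    finally have "c [^] r \<in> H" by (simp add: int_pow_int)
    then have "r = 0" using min[of r] r(2) by (auto simp: P_def)
    then have "m = int k * (m div int k)" using r(1) by auto
    then have "h = ?d [^] (m div int k)" using m mult by simp
    then show "h \<in> generate G {?d}"
      using c by (auto simp: generate_pow)
  qed
  moreover have "generate G {?d} \<subseteq> H"
    using d(1) by (intro generate_subgroup_incl[OF _ H]) auto
  ultimately show ?thesis using c by (intro bexI[of _ ?d]) auto
qed

text \<open>
  Since subgroups of cyclic groups are cyclic, the generator of a cyclic overgroup need not lie in
  the subgroup generated by \<open>S\<close>. This reduces all later questions of cyclicity to membership in
  \<open>generate G {c}\<close>, which is a subgroup and monotone under passing to a larger cyclic subgroup.
\<close>
lemma (in group) cyclic_group_subgroup_generated_iff: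
  assumes S: "S \<subseteq> carrier G"
  shows "cyclic_group (subgroup_generated G S) \<longleftrightarrow> (\<exists>c \<in> carrier G. S \<subseteq> generate G {c})"
proof
  assume "cyclic_group (subgroup_generated G S)"
  then obtain c where c: "c \<in> carrier (subgroup_generated G S)"
    and eq: "subgroup_generated (subgroup_generated G S) {c} = subgroup_generated G S"
    unfolding cyclic_group_def by blast
  have cG: "c \<in> carrier G" using c carrier_subgroup_generated_subset by blast
  have "carrier (subgroup_generated (subgroup_generated G S) {c}) = generate G {c}"
    using c generate_consistent[of "{c}" "generate G S"] generate_is_subgroup[OF S] S
    by (simp add: subgroup_generated_def Int_absorb1)
  then show "\<exists>c \<in> carrier G. S \<subseteq> generate G {c}"
    using eq cG subgroup_generated_subset_carrier_subset[OF S] by auto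
next
  assume "\<exists>c \<in> carrier G. S \<subseteq> generate G {c}"
  then obtain c where c: "c \<in> carrier G" and "S \<subseteq> generate G {c}" by blast
  then have "generate G S \<subseteq> generate G {c}"
    by (intro generate_subgroup_incl generate_is_subgroup) auto
  then obtain d where d: "d \<in> carrier G" "generate G S = generate G {d}"
    using cyclic_subgroup_of_generate_singleton[OF c generate_is_subgroup[OF S]] by blast
  then have "subgroup_generated G S = subgroup_generated G {d}"
    using S by (simp add: subgroup_generated_def Int_absorb1)
  then show "cyclic_group (subgroup_generated G S)"
    by (simp add: cyclic_group_generated)
qed

section \<open>The cyclicizer\<close>

text \<open>
  Given \<open>x\<close>, the element \<open>a\<close> allows one to enlarge \<open>\<langle>x\<rangle>\<close> to a cyclic subgroup \<open>\<langle>c\<rangle>\<close> that also contains \<open>a\<close>,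
  and then \<open>b\<close> allows one to enlarge \<open>\<langle>c\<rangle>\<close> to a cyclic subgroup that contains \<open>x\<close>, \<open>a\<close> and \<open>b\<close>, hence
  everything generated by \<open>a\<close> and \<open>b\<close>.
\<close>
lemma (in group) cyclicizer_closed:
  assumes "a \<in> cyclicizer G" "b \<in> cyclicizer G" "y \<in> generate G {a, b}"
  shows "y \<in> cyclicizer G"
proof -
  have ab: "a \<in> carrier G" "b \<in> carrier G"
    using assms by (auto simp: cyclicizer_def)
  then have y: "y \<in> carrier G"
    using assms(3) generate_in_carrier[of "{a, b}"] by auto
  have "cyclic_group (subgroup_generated G {x, y})" if x: "x \<in> carrier G" for x
  proof -
    obtain c where c: "c \<in> carrier G" "{x, a} \<subseteq> generate G {c}"
      using assms(1) x ab by (auto simp: cyclicizer_def cyclic_group_subgroup_generated_iff)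
    obtain d where d: "d \<in> carrier G" "{c, b} \<subseteq> generate G {d}"
      using assms(2) c(1) ab by (auto simp: cyclicizer_def cyclic_group_subgroup_generated_iff)
    have D: "subgroup (generate G {d}) G" using d by (auto intro: generate_is_subgroup)
    have "generate G {c} \<subseteq> generate G {d}"
      using d by (intro generate_subgroup_incl[OF _ D]) auto
    then have *: "x \<in> generate G {d}" "{a, b} \<subseteq> generate G {d}" using c d by auto
    have "generate G {a, b} \<subseteq> generate G {d}"
      using * by (intro generate_subgroup_incl[OF _ D])
    then show ?thesis
      using * x y d assms(3) by (auto simp: cyclic_group_subgroup_generated_iff)
  qed
  then show ?thesis using y by (simp add: cyclicizer_def)
qed

text \<open>
  A finite set is absorbed into a cyclic subgroup one element at a time. For a group that is not
  locally cyclic this gives the graph a vertex.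
\<close>
lemma (in group) locally_cyclic_if_cyclicizer_eq_carrier:
  assumes "cyclicizer G = carrier G"
  shows "locally_cyclic_group G"
proof -
  have "\<exists>c \<in> carrier G. S \<subseteq> generate G {c}" if "finite S" "S \<subseteq> carrier G" for S
    using that
  proof (induction rule: finite_induct)
    case empty
    then show ?case by auto
  next
    case (insert x S)
    then obtain c where c: "c \<in> carrier G" "S \<subseteq> generate G {c}" by auto
    have x: "x \<in> carrier G" using insert.prems by auto
    then have "x \<in> cyclicizer G" using assms by simp
    then obtain d where d: "d \<in> carrier G" "{c, x} \<subseteq> generate G {d}"
      using c x by (auto simp: cyclicizer_def cyclic_group_subgroup_generated_iff)
    have "generate G {c} \<subseteq> generate G {d}"
      using d by (intro generate_subgroup_incl generate_is_subgroup) auto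
    then show ?case using c d by blast
  qed
  then show ?thesis
    by (simp add: locally_cyclic_group_def cyclic_group_subgroup_generated_iff)
qed

lemma (in group) one_in_cyclicizer: "\<one> \<in> cyclicizer G"
proof -
  have "\<exists>c \<in> carrier G. {x, \<one>} \<subseteq> generate G {c}" if "x \<in> carrier G" for x
    using that by (intro bexI[of _ x]) (auto intro: generate.incl generate.one)
  then show ?thesis
    by (simp add: cyclicizer_def cyclic_group_subgroup_generated_iff)
qed

lemma (in group) inv_notin_cyclicizer:
  assumes "v \<in> carrier G - cyclicizer G"
  shows "inv v \<in> carrier G - cyclicizer G"
proof -
  have "inv v \<notin> cyclicizer G"
  proof
    assume *: "inv v \<in> cyclicizer G"
    have "inv (inv v) \<in> generate G {inv v, inv v}" by (rule generate.inv) simp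
    then show False using cyclicizer_closed[OF * *] assms by auto
  qed
  then show ?thesis using assms by simp
qed

lemma (in group) mult_notin_cyclicizer:
  assumes v: "v \<in> carrier G - cyclicizer G" and z: "z \<in> cyclicizer G"
  shows "v \<otimes> z \<in> carrier G - cyclicizer G"
proof -
  have zG: "z \<in> carrier G" using z by (simp add: cyclicizer_def)
  have "v \<otimes> z \<notin> cyclicizer G"
  proof
    assume *: "v \<otimes> z \<in> cyclicizer G"
    have "(v \<otimes> z) \<otimes> inv z \<in> generate G {v \<otimes> z, z}"
      by (intro generate.eng generate.incl generate.inv) auto
    then have "v \<in> generate G {v \<otimes> z, z}" using v zG by (simp add: m_assoc)
    then show False using cyclicizer_closed[OF * z] v by auto
  qed
  then show ?thesis using v zG by simp
qed

section \<open>The complement of the non-cyclic graph\<close>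

abbreviation cyclic_graph :: "('a, 'm) monoid_scheme \<Rightarrow> 'a pair_pre_digraph" where
  "cyclic_graph G \<equiv> graph_complement (non_cyclic_graph G)"

lemma pverts_cyclic_graph: "pverts (cyclic_graph G) = carrier G - cyclicizer G"
  by (simp add: graph_complement_def non_cyclic_graph_def)

lemma (in group) parcs_cyclic_graph_iff:
  "(u, v) \<in> parcs (cyclic_graph G) \<longleftrightarrow>
    u \<in> carrier G - cyclicizer G \<and> v \<in> carrier G - cyclicizer G \<and> u \<noteq> v \<and>
    (\<exists>c \<in> carrier G. u \<in> generate G {c} \<and> v \<in> generate G {c})"
  by (auto simp: graph_complement_def non_cyclic_graph_def cyclic_group_subgroup_generated_iff)

lemma (in group) eq_one_if_square_eq_one:
  assumes "odd (order G)" and x: "x \<in> carrier G" and sq: "x \<otimes> x = \<one>"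
  shows "x = \<one>"
proof -
  obtain k where k: "order G = 2 * k + 1" using assms(1) by (elim oddE)
  have "x [^] (2::nat) = \<one>"
    using x sq by (simp add: numeral_2_eq_2)
  then have "x [^] (2 * k) = \<one>"
    using x by (metis nat_pow_one nat_pow_pow)
  then have "x [^] (2 * k + 1) = x"
    using x by simp
  then show ?thesis using pow_order_eq_1[OF x] k by simp
qed

lemma (in group) inv_ne_self:
  assumes "odd (order G)" "v \<in> carrier G" "v \<noteq> \<one>"
  shows "inv v \<noteq> v"
  using assms eq_one_if_square_eq_one by (metis r_inv)

lemma (in group) arc_inv:
  assumes "odd (order G)" and v: "v \<in> carrier G - cyclicizer G"
  shows "(v, inv v) \<in> parcs (cyclic_graph G)"
proof -
  have "v \<noteq> \<one>" using v one_in_cyclicizer by auto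
  then have "v \<noteq> inv v" using inv_ne_self assms by force
  moreover have "v \<in> generate G {v}" "inv v \<in> generate G {v}"
    by (auto intro: generate.incl generate.inv)
  ultimately show ?thesis
    using v inv_notin_cyclicizer[OF v] by (auto simp: parcs_cyclic_graph_iff)
qed

text \<open>
  Together with \<open>arc_inv\<close> this says that mutually inverse vertices have the same closed
  neighbourhood.
\<close>
lemma (in group) arc_inv_left:
  assumes "(u, v) \<in> parcs (cyclic_graph G)" "v \<noteq> inv u"
  shows "(inv u, v) \<in> parcs (cyclic_graph G)"
proof -
  have "inv u \<in> generate G {c}" if "c \<in> carrier G" "u \<in> generate G {c}" for c
    using that by (intro generate_m_inv_closed) auto
  moreover have "inv u \<in> carrier G - cyclicizer G"
    using assms by (intro inv_notin_cyclicizer) (auto simp: parcs_cyclic_graph_iff)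
  ultimately show ?thesis using assms unfolding parcs_cyclic_graph_iff by blast
qed

lemma (in group) arc_mult_cyclicizer:
  assumes v: "v \<in> carrier G - cyclicizer G" and z: "z \<in> cyclicizer G" "z \<noteq> \<one>"
  shows "(v, v \<otimes> z) \<in> parcs (cyclic_graph G)"
proof -
  have zG: "z \<in> carrier G" using z by (simp add: cyclicizer_def)
  obtain c where c: "c \<in> carrier G" "{v, z} \<subseteq> generate G {c}"
    using z(1) zG v by (auto simp: cyclicizer_def cyclic_group_subgroup_generated_iff)
  then have "v \<otimes> z \<in> generate G {c}" by (auto intro: generate.eng)
  moreover have "v \<noteq> v \<otimes> z"
    using v z zG by (metis DiffD1 l_cancel_one')
  ultimately show ?thesis
    using v c mult_notin_cyclicizer[OF v z(1)] unfolding parcs_cyclic_graph_iff by blast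
qed

text \<open>
  An element \<open>z \<noteq> \<one>\<close> of the cyclicizer would give \<open>v\<close> the neighbours \<open>v \<otimes> z\<close> and \<open>v \<otimes> inv z\<close>, which
  both have to be \<open>inv v\<close>, so that \<open>z\<close> is its own inverse. This is impossible in odd order.
\<close>
lemma (in group) cyclicizer_trivial_if_arcs_inv:
  assumes "odd (order G)" and v: "v \<in> carrier G - cyclicizer G"
    and arcs: "\<And>u w. (u, w) \<in> parcs (cyclic_graph G) \<Longrightarrow> w = inv u"
  shows "cyclicizer G = {\<one>}"
proof -
  have "z = \<one>" if z: "z \<in> cyclicizer G" for z
  proof (rule ccontr)
    assume "z \<noteq> \<one>"
    have zG: "z \<in> carrier G" using z by (simp add: cyclicizer_def)
    have "inv z \<in> generate G {z, z}" by (rule generate.inv) simp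
    then have "inv z \<in> cyclicizer G" using cyclicizer_closed[OF z z] by simp
    moreover have "inv z \<noteq> \<one>" using \<open>z \<noteq> \<one>\<close> zG by (metis inv_inv inv_one)
    ultimately have "v \<otimes> inv z = inv v"
      using arcs arc_mult_cyclicizer[OF v] by blast
    moreover have "v \<otimes> z = inv v"
      using arcs arc_mult_cyclicizer[OF v z \<open>z \<noteq> \<one>\<close>] by blast
    ultimately have "inv z = z" using v zG by (metis DiffD1 inv_closed Units_l_cancel Units_eq)
    then show False using inv_ne_self[OF assms(1) zG \<open>z \<noteq> \<one>\<close>] by simp
  qed
  then show ?thesis using one_in_cyclicizer by blast
qed

theorem theorem10:
  fixes G :: "('a, 'm) monoid_scheme" and n t :: nat
  assumes "group G"
    and "finite (carrier G)"
    and "\<not> locally_cyclic_group G"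
    and "order G = n"
    and "card (cyclicizer G) = t"
    and "odd n"
    and "odd t"
  shows "real (domination_number (graph_complement (non_cyclic_graph G))) = (real n - real t) / 2
    \<longleftrightarrow> t = 1 \<and>
        graph_isomorphic (graph_complement (non_cyclic_graph G))
          (disjoint_copies ((n - 1) div 2) (path_graph 2))"
proof -
  interpret group G by (fact assms(1))
  let ?H = "cyclic_graph G"
  let ?V = "carrier G - cyclicizer G"
  let ?i = "m_inv G"
  have H: "pair_graph ?H"
    using assms(2) by (intro pair_graph_graph_complement pair_graph_non_cyclic_graph)
  have V: "pverts ?H = ?V" by (rule pverts_cyclic_graph)
  have odd: "odd (order G)" using assms by simp
  have inv: "?i v \<in> pverts ?H" "?i (?i v) = v" "?i v \<noteq> v" "(v, ?i v) \<in> parcs ?H"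
    if "v \<in> pverts ?H" for v
    using that inv_notin_cyclicizer[of v] arc_inv[OF odd, of v] unfolding V
    by (auto simp: parcs_cyclic_graph_iff)
  have sub: "cyclicizer G \<subseteq> carrier G" by (auto simp: cyclicizer_def)
  then have "card ?V = n - t"
    using assms(2,4,5) by (simp add: card_Diff_subset finite_subset order_def)
  moreover have "t \<le> n"
    using sub assms(2,4,5) by (auto simp: order_def intro: card_mono)
  ultimately have half: "real (domination_number ?H) = (real n - real t) / 2 \<longleftrightarrow>
      2 * domination_number ?H = card (pverts ?H)"
    unfolding V by (auto simp: of_nat_diff field_simps)
  show ?thesis
  proof
    assume "real (domination_number ?H) = (real n - real t) / 2"
    then have eq: "2 * domination_number ?H = card (pverts ?H)" using half by simp
    have arcs: "w = ?i u" if "(u, w) \<in> parcs ?H" for u w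
      using domination_number_less_half[OF H, of ?i u w] inv arc_inv_left that eq
      by fastforce
    obtain v where "v \<in> ?V"
      using locally_cyclic_if_cyclicizer_eq_carrier assms(3) sub by blast
    then have "cyclicizer G = {\<one>\<^bsub>G\<^esub>}"
      using cyclicizer_trivial_if_arcs_inv[OF odd _ arcs] by blast
    then have "t = 1" using assms(5) by simp
    moreover have "graph_isomorphic ?H (disjoint_copies (card (pverts ?H) div 2) (path_graph 2))"
      using arcs inv by (intro matching_isomorphic_copies_of_edge[OF H, of ?i]) blast+
    ultimately show "t = 1 \<and> graph_isomorphic ?H (disjoint_copies ((n - 1) div 2) (path_graph 2))"
      using \<open>card ?V = n - t\<close> V by simp
  next
    assume *: "t = 1 \<and> graph_isomorphic ?H (disjoint_copies ((n - 1) div 2) (path_graph 2))"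
    then have "domination_number ?H = (n - 1) div 2"
      using domination_number_isomorphic[OF H pair_graph_disjoint_copies[OF pair_graph_path_graph]]
        domination_number_copies_of_edge by metis
    moreover obtain k where "n = 2 * k + 1" using assms(6) by (elim oddE)
    ultimately show "real (domination_number ?H) = (real n - real t) / 2"
      using * by simp
  qed
qed

end
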